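(* Let $s=\psi(y)$, $y=y_1y_2\cdots$, be a characteristic Sturmian word. The minimal periods of the palindromic prefixes of every order of $s$ are maximal, i.e. for every $n\geq0$, $\pi(\psi(y_1\cdots y_n))\geq\pi(\psi(u_1\cdots u_n))$ for every characteristic Sturmian word $\psi(u_1u_2\cdots)$, if and only if $s=f$ or $s=E(f)$.
   Context: Let $\mathcal{A}=\{a,b\}$. For $w\in\mathcal{A}^*$, $w^{(+)}$ is the shortest palindrome having $w$ as a prefix; $\psi(\varepsilon)=\varepsilon$, $\psi(vx)=(\psi(v)x)^{(+)}$. $\psi$ extends to infinite words by $\psi(y)=\lim_n\psi(y_1\cdots y_n)$ ($y$ is the directive word). Characteristic Sturmian words are exactly the words $\psi(y)$ with both $a$ and $b$ occurring infinitely often in $y$; the palindromic prefix of order $n$ of $\psi(y)$ is $\psi(y_1\cdots y_n)$. $\pi(w)$ is the minimal period of $w$, with $\pi(\varepsilon)=1$. $f=\psi((ab)^\omega)$ is the Fibonacci word, and $E$ exchanges the letters $a$ and $b$. *)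

theory Defs
  imports "HOL-Library.Stream" "HOL-Library.Sublist"
begin

datatype letter = A | B

definition palindrome :: "'a list \<Rightarrow> bool" where
  "palindrome w \<longleftrightarrow> rev w = w"

definition pal_closure :: "'a list \<Rightarrow> 'a list" where
  "pal_closure w = (ARG_MIN length p. palindrome p \<and> prefix w p)"

definition psi :: "'a list \<Rightarrow> 'a list" where
  "psi w = foldl (\<lambda>p x. pal_closure (p @ [x])) [] w"

lemma psi_Nil: "psi [] = []"
  by (simp add: psi_def)

lemma psi_snoc: "psi (v @ [x]) = pal_closure (psi v @ [x])"
  by (simp add: psi_def)

lemma pal_closure_props:
  shows palindrome_pal_closure: "palindrome (pal_closure w)"
    and prefix_pal_closure: "prefix w (pal_closure w)"
    and pal_closure_le: "palindrome p \<Longrightarrow> prefix w p \<Longrightarrow> length (pal_closure w) \<le> length p"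
proof -
  have ex: "palindrome (w @ rev w) \<and> prefix w (w @ rev w)"
    by (simp add: palindrome_def)
  note * = arg_min_nat_lemma[where P = "\<lambda>p. palindrome p \<and> prefix w p" and m = length, OF ex]
  show "palindrome (pal_closure w)" "prefix w (pal_closure w)"
    "palindrome p \<Longrightarrow> prefix w p \<Longrightarrow> length (pal_closure w) \<le> length p"
    using * by (auto simp: pal_closure_def)
qed

text \<open>The shortest palindrome with a given prefix is unique, so the choice made by
  \<open>ARG_MIN\<close> is immaterial.\<close>

lemma pal_closure_unique:
  assumes "palindrome p" "prefix w p"
    and min: "\<And>q. palindrome q \<Longrightarrow> prefix w q \<Longrightarrow> length p \<le> length q"
  shows "p = pal_closure w"
proof (rule nth_equalityI)
  let ?q = "pal_closure w"
  show len: "length p = length ?q"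
    using pal_closure_le[OF assms(1,2)] min[OF palindrome_pal_closure prefix_pal_closure]
    by (rule le_antisym[rotated])
  have short: "length p \<le> length w + length w"
    using min[of "w @ rev w"] by (simp add: palindrome_def)
  fix i assume i: "i < length p"
  have mirror: "r ! j = r ! (length r - Suc j)" if "palindrome r" "j < length r"
    for r :: "'a list" and j
    using rev_nth[OF that(2)] that(1) by (simp add: palindrome_def)
  have agree: "p ! j = ?q ! j" if "j < length w" for j
    using that assms(2) prefix_pal_closure[of w] by (auto simp: prefix_def nth_append)
  show "p ! i = ?q ! i"
  proof (cases "i < length w")
    case True
    then show ?thesis by (rule agree)
  next
    case False
    have "p ! i = p ! (length p - Suc i)" by (rule mirror[OF assms(1) i])
    also have "\<dots> = ?q ! (length p - Suc i)" by (rule agree) (use False short i in linarith)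
    also have "\<dots> = ?q ! i" using mirror[OF palindrome_pal_closure, of i w] i len by simp
    finally show ?thesis .
  qed
qed

definition converges_to :: "(nat \<Rightarrow> 'a list) \<Rightarrow> 'a stream \<Rightarrow> bool" where
  "converges_to w s \<longleftrightarrow> (\<forall>k. \<forall>\<^sub>F n in sequentially. prefix (stake k s) (w n))"

text \<open>The limit exists for every directive word, see \<open>converges_to_psi_inf\<close> below.\<close>

definition psi_inf :: "'a stream \<Rightarrow> 'a stream" where
  "psi_inf y = (THE s. converges_to (\<lambda>n. psi (stake n y)) s)"

lemma converges_to_unique:
  assumes "converges_to w s" "converges_to w t"
  shows "s = t"
proof -
  have "stake k s = stake k t" for k
  proof -
    have "\<forall>\<^sub>F n in sequentially. prefix (stake k s) (w n) \<and> prefix (stake k t) (w n)"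
      using assms by (auto simp: converges_to_def intro: eventually_conj)
    then obtain n where "prefix (stake k s) (w n)" "prefix (stake k t) (w n)"
      using eventually_happens' sequentially_bot by blast
    then have "take k (w n) = stake k s" "take k (w n) = stake k t"
      by (auto simp: prefix_def)
    then show ?thesis by simp
  qed
  then have "s !! i = t !! i" for i
    using stake_nth[of i "Suc i" s] stake_nth[of i "Suc i" t] by (simp del: stake.simps)
  then show ?thesis
    using smap_alt[of id s t] by (simp add: stream.map_id)
qed

lemma prefix_psi_stake_Suc: "prefix (psi (stake n y) @ [y !! n]) (psi (stake (Suc n) y))"
  by (simp only: stake_Suc psi_snoc prefix_pal_closure)

lemma prefix_psi_stake: "m \<le> n \<Longrightarrow> prefix (psi (stake m y)) (psi (stake n y))"
proof (induction n rule: dec_induct)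
  case (step n)
  then show ?case
    using prefix_psi_stake_Suc[of n y] by (blast dest: append_prefixD intro: prefix_order.trans)
qed simp

lemma length_psi_stake: "n \<le> length (psi (stake n y))"
proof (induction n)
  case (Suc n)
  then show ?case
    using prefix_length_le[OF prefix_psi_stake_Suc[of n y]] by (simp del: stake.simps)
qed simp

lemma converges_to_psi_inf: "converges_to (\<lambda>n. psi (stake n y)) (psi_inf y)"
proof -
  define s where "s = smap (\<lambda>i. psi (stake (Suc i) y) ! i) nats"
  have "prefix (stake k s) (psi (stake n y))" if "k \<le> n" for k n
  proof -
    have kn: "k \<le> length (psi (stake n y))"
      using that length_psi_stake le_trans by blast
    have "stake k s = take k (psi (stake n y))"
    proof (rule nth_equalityI)
      fix i assume "i < length (stake k s)"
      then have i: "i < k" by simp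
      have "prefix (psi (stake (Suc i) y)) (psi (stake n y))"
        using i that by (intro prefix_psi_stake) simp
      moreover have "i < length (psi (stake (Suc i) y))"
        using length_psi_stake[of "Suc i" y] by simp
      ultimately show "stake k s ! i = take k (psi (stake n y)) ! i"
        using i by (auto simp: s_def prefix_def nth_append simp del: stake.simps)
    qed (use kn in simp)
    then show ?thesis by (simp add: take_is_prefix)
  qed
  then have lim: "converges_to (\<lambda>n. psi (stake n y)) s"
    unfolding converges_to_def eventually_sequentially by blast
  then have "psi_inf y = s"
    unfolding psi_inf_def by (rule the_equality) (erule converges_to_unique[OF _ lim])
  with lim show ?thesis by simp
qed

text \<open>The description of characteristic Sturmian words by their directive words is taken
  as the definition.\<close>

definition char_sturmian :: "letter stream \<Rightarrow> bool" where
  "char_sturmian s \<longleftrightarrow>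
    (\<exists>y. infinite {n. y !! n = A} \<and> infinite {n. y !! n = B} \<and> s = psi_inf y)"

definition fibonacci_word :: "letter stream" where
  "fibonacci_word = psi_inf (cycle [A, B])"

fun exch :: "letter \<Rightarrow> letter" where
  "exch A = B"
| "exch B = A"

definition is_period :: "nat \<Rightarrow> 'a list \<Rightarrow> bool" where
  "is_period p w \<longleftrightarrow> 0 < p \<and> (\<forall>i. i + p < length w \<longrightarrow> w ! i = w ! (i + p))"

definition min_period :: "'a list \<Rightarrow> nat" where
  "min_period w = (LEAST p. is_period p w)"

text \<open>The convention for the empty word needs no separate case.\<close>

lemma min_period_Nil: "min_period [] = 1"
  unfolding min_period_def by (rule Least_equality) (auto simp: is_period_def)

end

theory Submission
  imports Defs "HOL-Number_Theory.Fib"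
begin

text \<open>For a word \<open>v\<close> and a letter \<open>x\<close> let \<open>P\<^sub>x(v)\<close> be the minimal period of \<open>\<psi>(v)x\<close>. The
  palindromic closure of \<open>\<psi>(v)x\<close> has the same minimal period, so \<open>\<pi>(\<psi>(vx)) = P\<^sub>x(v)\<close>. Starting
  from \<open>(1, 1)\<close>, appending \<open>x\<close> to \<open>v\<close> keeps \<open>P\<^sub>x\<close> and replaces the other component by the sum of
  both. The largest component at depth \<open>n\<close> is therefore at most a Fibonacci number, attained along
  alternating directive words. Conversely, repeating a letter selects the strictly smaller
  component, which a competitor that switches letters at this place beats.\<close>

section \<open>Periods of palindromes and of palindromic closures\<close>

lemma palindrome_nth:
  assumes "palindrome w" "i < length w"
  shows "w ! (length w - Suc i) = w ! i"
  using rev_nth[OF assms(2)] assms(1) by (simp add: palindrome_def)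

lemma prefix_nth: "prefix v w \<Longrightarrow> i < length v \<Longrightarrow> w ! i = v ! i"
  by (auto simp: prefix_def nth_append)

lemma is_period_length: "w \<noteq> [] \<Longrightarrow> is_period (length w) w"
  by (simp add: is_period_def)

lemma is_period_prefix: "is_period p w \<Longrightarrow> prefix v w \<Longrightarrow> is_period p v"
  by (auto simp: is_period_def prefix_def nth_append dest: add_lessD1 split: if_splits)

lemma min_period_le: "is_period p w \<Longrightarrow> min_period w \<le> p"
  by (simp add: min_period_def Least_le)

lemma min_period_eqI:
  "is_period p w \<Longrightarrow> (\<And>r. is_period r w \<Longrightarrow> p \<le> r) \<Longrightarrow> min_period w = p"
  unfolding min_period_def by (rule Least_equality)

lemma is_period_min_period:
  assumes "w \<noteq> []"
  shows "is_period (min_period w) w"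
  unfolding min_period_def by (rule LeastI[of _ "length w"]) (rule is_period_length[OF assms])

text \<open>Reflecting a position first inside \<open>w\<close> and then inside \<open>c\<close> is
  the translation by the difference of the two lengths, and both reflections preserve the
  letter.\<close>

lemma is_period_palindrome:
  assumes c: "palindrome c" and w: "palindrome w" and pre: "prefix w c"
    and len: "length w < length c"
  shows "is_period (length c - length w) c"
  unfolding is_period_def
proof (intro conjI allI impI)
  fix i assume "i + (length c - length w) < length c"
  then have i: "i < length w" using len by linarith
  have "c ! i = w ! (length w - Suc i)"
    using prefix_nth[OF pre i] palindrome_nth[OF w i] by simp
  also have "\<dots> = c ! (length w - Suc i)"
    using prefix_nth[OF pre, of "length w - Suc i"] i by simp
  also have "\<dots> = c ! (length c - Suc (length w - Suc i))"
    using palindrome_nth[OF c, of "length w - Suc i"] i len by simp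
  also have "length c - Suc (length w - Suc i) = i + (length c - length w)"
    using i len by simp
  finally show "c ! i = c ! (i + (length c - length w))" .
qed (use len in simp)

text \<open>Supplies a competitor for the palindromic closure of \<open>w @ [x]\<close>: each period
  \<open>p\<close> up to \<open>Suc (length w)\<close> gives a palindrome of length
  \<open>length w + p\<close>.\<close>

lemma palindrome_extension:
  assumes w: "palindrome w" and per: "is_period p (w @ [x])" and p: "p \<le> Suc (length w)"
  shows "prefix (w @ [x]) (take p (w @ [x]) @ w)" "palindrome (take p (w @ [x]) @ w)"
proof -
  let ?q = "take p (w @ [x]) @ w"
  have len: "length ?q = length w + p" using p by simp
  have pre: "?q ! i = (w @ [x]) ! i" if "i \<le> length w" for i
  proof (cases "i < p")
    case False
    then have "(w @ [x]) ! (i - p) = (w @ [x]) ! i"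
      using per that unfolding is_period_def
      by (metis le_add_diff_inverse2 length_append_singleton less_Suc_eq_le not_le)
    moreover have "i - p < length w" using False that per by (auto simp: is_period_def)
    moreover have "p \<le> length w" using False that by simp
    ultimately show ?thesis using False by (simp add: nth_append)
  qed (use p in \<open>simp add: nth_append\<close>)
  have "w @ [x] = take (Suc (length w)) ?q"
  proof (rule nth_equalityI)
    \<comment> \<open>Positivity makes \<open>?q\<close> strictly longer than \<open>w\<close>, so
      cutting it at \<open>Suc (length w)\<close> leaves exactly that many letters.\<close>
    have "0 < p" using per by (simp add: is_period_def)
    with len show "length (w @ [x]) = length (take (Suc (length w)) ?q)"
      by (simp only: length_append_singleton length_take)
    show "(w @ [x]) ! i = take (Suc (length w)) ?q ! i" if "i < length (w @ [x])" for i
      using that pre[of i] by (simp del: take_append)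
  qed
  then show "prefix (w @ [x]) ?q" by (metis take_is_prefix)
  have mirror: "?q ! (length w + p - Suc i) = ?q ! i" if i: "i < length w" for i
  proof -
    have "?q ! (length w + p - Suc i) = w ! (length w - Suc i)"
      using nth_append_length_plus[of "take p (w @ [x])" w "length w - Suc i"] i p
      by (simp del: take_append add: min_absorb2 add.commute)
    then show ?thesis using palindrome_nth[OF w i] pre[of i] i by (simp add: nth_append)
  qed
  have "?q ! (length w + p - Suc i) = ?q ! i" if i: "i < length w + p" for i
  proof -
    define j where "j = length w + p - Suc i"
    \<comment> \<open>Since \<open>i + j = length w + p - 1\<close> is at most
      \<open>2 * length w\<close>, two positions outside the prefix \<open>w\<close> must both equal
      \<open>length w\<close>.\<close>
    consider "i < length w" | "j < length w" | "i = j" using i p unfolding j_def by linarith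
    then show ?thesis
    proof cases
      case 2
      moreover have "length w + p - Suc j = i" using i by (simp add: j_def)
      ultimately show ?thesis using mirror[of j] by (simp add: j_def)
    qed (use mirror in \<open>simp_all add: j_def\<close>)
  qed
  then show "palindrome ?q"
    unfolding palindrome_def using len
    by (intro nth_equalityI) (simp_all only: length_rev rev_nth)
qed

text \<open>For the upper bound, extend \<open>w @ [x]\<close> by its minimal period. For the lower
  bound, the closure is a palindrome beginning with the palindrome \<open>w\<close>, so the excess
  of its length is a period, which the prefix \<open>w @ [x]\<close> inherits.\<close>

lemma length_pal_closure_snoc:
  assumes w: "palindrome w"
  shows "length (pal_closure (w @ [x])) = length w + min_period (w @ [x])"
proof (rule antisym)
  let ?p = "min_period (w @ [x])" and ?c = "pal_closure (w @ [x])"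
  have per: "is_period ?p (w @ [x])" by (rule is_period_min_period) simp
  have p: "?p \<le> Suc (length w)" using min_period_le[OF is_period_length[of "w @ [x]"]] by simp
  show "length ?c \<le> length w + ?p"
    using pal_closure_le[OF palindrome_extension(2,1)[OF w per p]] p by simp
  have pre: "prefix (w @ [x]) ?c" by (rule prefix_pal_closure)
  have len: "length w < length ?c" using prefix_length_le[OF pre] by simp
  have "is_period (length ?c - length w) ?c"
    by (rule is_period_palindrome[OF palindrome_pal_closure w append_prefixD[OF pre] len])
  from min_period_le[OF is_period_prefix[OF this pre]] len
  show "length w + ?p \<le> length ?c" by simp
qed

lemma min_period_pal_closure_snoc:
  assumes w: "palindrome w"
  shows "min_period (pal_closure (w @ [x])) = min_period (w @ [x])"
proof (rule min_period_eqI)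
  let ?c = "pal_closure (w @ [x])"
  have pre: "prefix (w @ [x]) ?c" by (rule prefix_pal_closure)
  have len: "length w < length ?c" using prefix_length_le[OF pre] by simp
  show "is_period (min_period (w @ [x])) ?c"
    using is_period_palindrome[OF palindrome_pal_closure w append_prefixD[OF pre] len]
    by (simp add: length_pal_closure_snoc[OF w])
  show "min_period (w @ [x]) \<le> r" if "is_period r ?c" for r
    by (rule min_period_le[OF is_period_prefix[OF that pre]])
qed

text \<open>The appended \<open>x\<close> lies one period after position \<open>length w\<close> of
  the closure, which also carries \<open>x\<close>, so the period survives.\<close>

lemma min_period_pal_closure_snoc_same:
  assumes w: "palindrome w"
  shows "min_period (pal_closure (w @ [x]) @ [x]) = min_period (w @ [x])"
proof (rule min_period_eqI)
  let ?c = "pal_closure (w @ [x])" and ?p = "min_period (w @ [x])"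
  have len: "length ?c = length w + ?p" by (rule length_pal_closure_snoc[OF w])
  have ne: "?c \<noteq> []" using prefix_pal_closure[of "w @ [x]"] by auto
  have per: "is_period ?p ?c"
    using is_period_min_period[OF ne] min_period_pal_closure_snoc[OF w] by simp
  have last: "?c ! length w = x"
    using prefix_nth[OF prefix_pal_closure, of "length w" "w @ [x]"] by simp
  show "is_period ?p (?c @ [x])"
    unfolding is_period_def
  proof (intro conjI allI impI)
    fix i assume "i + ?p < length (?c @ [x])"
    then consider "i + ?p < length ?c" | "i = length w" using len by force
    then show "(?c @ [x]) ! i = (?c @ [x]) ! (i + ?p)"
    proof cases
      case 1
      then show ?thesis using per by (simp add: is_period_def nth_append)
    next
      case 2
      moreover have "0 < ?p" using per by (simp add: is_period_def)
      ultimately show ?thesis using last len by (simp add: nth_append)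
    qed
  qed (use per in \<open>simp add: is_period_def\<close>)
  show "?p \<le> r" if "is_period r (?c @ [x])" for r
    using min_period_le[OF is_period_prefix[OF that, of ?c]] min_period_pal_closure_snoc[OF w, of x]
    by simp
qed

text \<open>The word \<open>?c @ [y]\<close> begins with \<open>w @ [x]\<close> and ends with
  \<open>w @ [y]\<close>, the latter at offset \<open>?p\<close>. Hence a period
  \<open>r > ?p\<close> of it amounts to a period \<open>r - ?p\<close> of
  \<open>w @ [y]\<close>.\<close>

lemma min_period_pal_closure_snoc_other:
  assumes w: "palindrome w" and "x \<noteq> y"
  shows "min_period (pal_closure (w @ [x]) @ [y]) =
    min_period (w @ [x]) + min_period (w @ [y])"
proof (rule min_period_eqI)
  let ?c = "pal_closure (w @ [x])"
  let ?p = "min_period (w @ [x])" and ?q = "min_period (w @ [y])"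
  have len: "length ?c = length w + ?p" by (rule length_pal_closure_snoc[OF w])
  have pre: "?c ! i = (w @ [x]) ! i" if "i \<le> length w" for i
    using prefix_nth[OF prefix_pal_closure, of i "w @ [x]"] that by simp
  have ne: "?c \<noteq> []" using prefix_pal_closure[of "w @ [x]"] by auto
  have per: "is_period ?p ?c"
    using is_period_min_period[OF ne] min_period_pal_closure_snoc[OF w] by simp
  then have p: "0 < ?p" by (simp add: is_period_def)
  \<comment> \<open>The closure has length \<open>length w + ?p\<close>, so its period places a copy
    of \<open>w\<close> at its end.\<close>
  have shift: "?c ! (i + ?p) = w ! i" if "i < length w" for i
    using per pre[of i] that len by (simp add: is_period_def nth_append)
  have perq: "is_period ?q (w @ [y])" by (rule is_period_min_period) simp
  show "is_period (?p + ?q) (?c @ [y])"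
    unfolding is_period_def
  proof (intro conjI allI impI)
    fix i assume "i + (?p + ?q) < length (?c @ [y])"
    then have i: "i + ?q \<le> length w" using len by simp
    have q: "0 < ?q" using perq by (simp add: is_period_def)
    have "(?c @ [y]) ! (i + (?p + ?q)) = (w @ [y]) ! (i + ?q)"
      using shift[of "i + ?q"] i len by (auto simp: nth_append ac_simps)
    also have "\<dots> = (w @ [y]) ! i" using perq i by (simp add: is_period_def)
    also have "\<dots> = (?c @ [y]) ! i" using pre[of i] i q len by (simp add: nth_append)
    finally show "(?c @ [y]) ! i = (?c @ [y]) ! (i + (?p + ?q))" by simp
  qed (use p in simp)
  show "?p + ?q \<le> r" if r: "is_period r (?c @ [y])" for r
  proof -
    have "?p \<le> r"
      using min_period_le[OF is_period_prefix[OF r, of ?c]] min_period_pal_closure_snoc[OF w, of x]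
      by simp
    \<comment> \<open>Period \<open>?p\<close> would identify the \<open>x\<close> at position
      \<open>length w\<close> with the final \<open>y\<close>.\<close>
    moreover have "r \<noteq> ?p"
    proof
      assume "r = ?p"
      then have "(?c @ [y]) ! length w = (?c @ [y]) ! (length w + ?p)"
        using r len by (simp add: is_period_def)
      then show False using pre[of "length w"] p len \<open>x \<noteq> y\<close> by (simp add: nth_append)
    qed
    ultimately have rp: "?p < r" by simp
    have "is_period (r - ?p) (w @ [y])"
      unfolding is_period_def
    proof (intro conjI allI impI)
      fix i assume "i + (r - ?p) < length (w @ [y])"
      then have i: "i + r \<le> length ?c" using rp len by simp
      define j where "j = i + (r - ?p)"
      have j: "i + r = j + ?p" "j \<le> length w" using i rp len by (simp_all add: j_def)
      have "(w @ [y]) ! i = (?c @ [y]) ! i"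
        using pre[of i] i rp len by (simp add: nth_append)
      also have "\<dots> = (?c @ [y]) ! (i + r)" using r i by (simp add: is_period_def)
      also have "\<dots> = (w @ [y]) ! j"
      proof (cases "j < length w")
        case True
        then show ?thesis using shift[of j] j len by (simp add: nth_append)
      next
        case False
        then have "j = length w" using j(2) by simp
        then show ?thesis using j(1) len by (simp add: nth_append)
      qed
      finally show "(w @ [y]) ! i = (w @ [y]) ! (i + (r - ?p))" by (simp add: j_def)
    qed (use rp in simp)
    from min_period_le[OF this] rp show ?thesis by simp
  qed
qed

section \<open>The recurrence for the periods and the Fibonacci bound\<close>

text \<open>This is \<open>P\<^sub>x(v)\<close> of the overview.\<close>

definition ext_period :: "'a list \<Rightarrow> 'a \<Rightarrow> nat" where
  "ext_period v x = min_period (psi v @ [x])"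

lemma palindrome_psi: "palindrome (psi v)"
  by (cases v rule: rev_cases)
    (simp add: psi_Nil palindrome_def, simp add: psi_snoc palindrome_pal_closure)

lemma min_period_psi_snoc: "min_period (psi (v @ [x])) = ext_period v x"
  by (simp add: psi_snoc ext_period_def min_period_pal_closure_snoc palindrome_psi)

lemma ext_period_Nil: "ext_period [] x = 1"
  unfolding ext_period_def psi_Nil by (rule min_period_eqI) (auto simp: is_period_def)

lemma ext_period_snoc:
  "ext_period (v @ [x]) y = (if x = y then ext_period v y else ext_period v x + ext_period v y)"
  by (simp add: ext_period_def psi_snoc palindrome_psi
      min_period_pal_closure_snoc_same min_period_pal_closure_snoc_other)

lemma ext_period_pos: "0 < ext_period v x"
  using is_period_min_period[of "psi v @ [x]"] by (simp add: ext_period_def is_period_def)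

text \<open>The bounds need a joint induction: a new component is at most the old sum, and the new
  sum is the old sum plus one old component.\<close>

lemma ext_period_le_fib:
  fixes v :: "letter list"
  shows "ext_period v x \<le> fib (length v + 2)"
    and "ext_period v A + ext_period v B \<le> fib (length v + 3)"
proof (induction v arbitrary: x rule: rev_induct)
  case Nil
  {
    case 1
    show ?case by (simp add: ext_period_Nil)
  next
    case 2
    show ?case by (simp add: ext_period_Nil eval_nat_numeral)
  }
next
  case (snoc z v)
  note IH = snoc(1)[of A] snoc(1)[of B] snoc(2)
  {
    case 1
    show ?case using IH
      by (cases x; cases z) (simp_all add: ext_period_snoc eval_nat_numeral)
  next
    case 2
    show ?case using IH
      by (cases z) (simp_all add: ext_period_snoc eval_nat_numeral)
  }
qed

section \<open>Alternating directive words\<close>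

definition alternating :: "'a stream \<Rightarrow> bool" where
  "alternating y \<longleftrightarrow> (\<forall>n. y !! Suc n \<noteq> y !! n)"

text \<open>The letter to be appended next is the one not just appended, so its component has become
  the sum, while the other has kept its value. The pair thus runs through consecutive Fibonacci
  numbers.\<close>

lemma ext_period_alternating:
  fixes y :: "letter stream"
  assumes "alternating y"
  shows "ext_period (stake n y) (y !! n) = fib (n + 2) \<and>
    ext_period (stake n y) (exch (y !! n)) = fib (n + 1)"
proof (induction n)
  case (Suc n)
  have "y !! Suc n = exch (y !! n)"
    using assms by (cases "y !! n"; cases "y !! Suc n") (auto simp: alternating_def dest: spec[of _ n])
  moreover have "exch (exch (y !! n)) = y !! n" "y !! n \<noteq> exch (y !! n)"
    by (cases "y !! n"; simp)+
  ultimately show ?case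
    using Suc by (simp add: stake_Suc ext_period_snoc del: stake.simps snth.simps)
qed (simp add: ext_period_Nil)

lemma alternating_eqI:
  fixes y z :: "letter stream"
  assumes "alternating y" "alternating z" "y !! 0 = z !! 0"
  shows "y = z"
proof -
  have "y !! n = z !! n" for n
  proof (induction n)
    case (Suc n)
    have "y !! Suc n \<noteq> y !! n" "z !! Suc n \<noteq> z !! n"
      using assms(1,2) unfolding alternating_def by blast+
    with Suc show ?case
      by (cases "y !! n"; cases "y !! Suc n"; cases "z !! Suc n") simp_all
  qed (rule assms(3))
  then show ?thesis using smap_alt[of id y z] by (simp add: stream.map_id)
qed

lemma snth_cycle_AB: "cycle [A, B] !! n = (if even n then A else B)"
proof (induction n rule: induct_nat_012)
  case (ge2 n)
  have "cycle [A, B] !! Suc (Suc n) = ([A, B] @- cycle [A, B]) !! Suc (Suc n)"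
    by (subst cycle_decomp) simp_all
  with ge2(1) show ?case by simp
qed simp_all

lemma alternating_iff:
  "alternating y \<longleftrightarrow> y = cycle [A, B] \<or> y = smap exch (cycle [A, B])"
proof -
  have alt: "alternating (cycle [A, B])" "alternating (smap exch (cycle [A, B]))"
    unfolding alternating_def snth_smap snth_cycle_AB by simp_all
  moreover have "y !! 0 = cycle [A, B] !! 0 \<or> y !! 0 = smap exch (cycle [A, B]) !! 0"
    unfolding snth_smap snth_cycle_AB by (cases "y !! 0") simp_all
  ultimately show ?thesis by (blast intro: alternating_eqI)
qed

section \<open>Recovering the directive word, and exchanging the letters\<close>

lemma prefix_psi_inf: "psi (stake n y) = stake (length (psi (stake n y))) (psi_inf y)"
proof -
  let ?k = "length (psi (stake n y))"
  obtain N where N: "prefix (stake ?k (psi_inf y)) (psi (stake m y))" if "m \<ge> N" for m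
    using converges_to_psi_inf[of y] unfolding converges_to_def eventually_sequentially by blast
  have "prefix (psi (stake n y)) (psi (stake (max n N) y))" by (rule prefix_psi_stake) simp
  with N[of "max n N"] show ?thesis
    by (auto simp: prefix_def append_eq_append_conv simp del: stake.simps)
qed

text \<open>In the limit word, each palindromic prefix is followed by the next directive letter, so
  the directive word can be read off letter by letter.\<close>

lemma inj_psi_inf: "psi_inf y = psi_inf z \<Longrightarrow> y = z"
proof -
  assume eq: "psi_inf y = psi_inf z"
  have next_letter: "psi_inf u !! length (psi (stake n u)) = u !! n" for n and u :: "'a stream"
  proof -
    let ?p = "psi (stake (Suc n) u)" and ?k = "length (psi (stake n u))"
    have "?k < length ?p" and "?p ! ?k = u !! n"
      using prefix_psi_stake_Suc[of n u] by (auto simp: prefix_def simp del: stake.simps)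
    then show ?thesis by (subst (asm) (2) prefix_psi_inf) simp
  qed
  have "stake n y = stake n z" for n
  proof (induction n)
    case (Suc n)
    then have "y !! n = z !! n" using next_letter[of y n] next_letter[of z n] eq by simp
    with Suc show ?case by (simp add: stake_Suc del: stake.simps)
  qed simp
  then have "y !! n = z !! n" for n
    using stake_nth[of n "Suc n" y] stake_nth[of n "Suc n" z] by (simp del: stake.simps)
  then show ?thesis using smap_alt[of id y z] by (simp add: stream.map_id)
qed

text \<open>The exchange is an involution that preserves lengths and palindromes, so it matches the
  candidates for both closures; uniqueness of the shortest one settles the choice.\<close>

lemma pal_closure_map_exch: "pal_closure (map exch w) = map exch (pal_closure w)"
proof (rule pal_closure_unique[symmetric])
  have inv: "map exch (map exch q) = q" for q
  proof -
    have "exch \<circ> exch = id" by (rule ext) (metis comp_apply exch.simps id_apply letter.exhaust)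
    then show ?thesis by simp
  qed
  have pal: "palindrome (map exch q)" if "palindrome q" for q
    using that by (simp add: palindrome_def rev_map)
  show "palindrome (map exch (pal_closure w))" by (rule pal[OF palindrome_pal_closure])
  show "prefix (map exch w) (map exch (pal_closure w))"
    by (rule map_mono_prefix[OF prefix_pal_closure])
  show "length (map exch (pal_closure w)) \<le> length q"
    if "palindrome q" "prefix (map exch w) q" for q
    using pal_closure_le[OF pal[OF that(1)], of w] map_mono_prefix[OF that(2), of exch] inv[of w]
    by simp
qed

lemma psi_map_exch: "psi (map exch w) = map exch (psi w)"
proof (induction w rule: rev_induct)
  case (snoc x w)
  have "pal_closure (map exch (psi w) @ [exch x]) = map exch (pal_closure (psi w @ [x]))"
    using pal_closure_map_exch[of "psi w @ [x]"] by simp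
  with snoc show ?case by (simp add: psi_snoc)
qed (simp add: psi_Nil)

lemma psi_inf_smap_exch: "psi_inf (smap exch y) = smap exch (psi_inf y)"
proof -
  have "converges_to (\<lambda>n. psi (stake n (smap exch y))) (smap exch (psi_inf y))"
    using converges_to_psi_inf[of y] unfolding converges_to_def
    by (auto simp: stake_smap psi_map_exch intro: map_mono_prefix elim!: eventually_mono)
  then show ?thesis by (rule converges_to_unique[OF converges_to_psi_inf])
qed

section \<open>Competitors and maximality of the periods\<close>

text \<open>Allows a competitor to be prescribed on any finite initial part of its directive
  word.\<close>

lemma char_sturmian_shift_cycle: "char_sturmian (psi_inf (v @- cycle [A, B]))"
proof -
  have snth: "(v @- cycle [A, B]) !! (length v + n) = (if even n then A else B)" for n
    by (simp add: shift_snth_ge snth_cycle_AB)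
  have "\<exists>n\<ge>m. (v @- cycle [A, B]) !! n = A" "\<exists>n\<ge>m. (v @- cycle [A, B]) !! n = B" for m
    using snth[of "2 * m"] snth[of "2 * m + 1"]
    by (intro exI[of _ "length v + 2 * m"] exI[of _ "length v + (2 * m + 1)"]; simp)+
  then have "infinite {n. (v @- cycle [A, B]) !! n = A}"
    "infinite {n. (v @- cycle [A, B]) !! n = B}"
    by (simp_all add: frequently_cofinite[symmetric] cofinite_eq_sequentially
        frequently_sequentially)
  then show ?thesis unfolding char_sturmian_def by blast
qed

lemma min_period_psi_stake_Suc:
  "min_period (psi (stake (Suc n) y)) = ext_period (stake n y) (y !! n)"
  by (simp only: stake_Suc min_period_psi_snoc)

lemma min_period_psi_maximal_iff:
  fixes y :: "letter stream"
  shows "(\<forall>n u. char_sturmian (psi_inf u) \<longrightarrow>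
            min_period (psi (stake n u)) \<le> min_period (psi (stake n y))) \<longleftrightarrow> alternating y"
proof
  assume max: "\<forall>n u. char_sturmian (psi_inf u) \<longrightarrow>
    min_period (psi (stake n u)) \<le> min_period (psi (stake n y))"
  show "alternating y"
    unfolding alternating_def
  proof (intro allI notI)
    fix n assume same: "y !! Suc n = y !! n"
    let ?x = "y !! n"
    \<comment> \<open>The competitor follows \<open>y\<close> through the first of the two equal
      letters and then switches.\<close>
    define v where "v = stake (Suc n) y @ [exch ?x]"
    define u where "u = v @- cycle [A, B]"
    have "length v = Suc (Suc n)" by (simp add: v_def)
    moreover have "stake (length v) u = v" unfolding u_def stake_append by simp
    ultimately have "stake (Suc (Suc n)) u = v" by (simp only:)
    then have "ext_period (stake (Suc n) y) (exch ?x) \<le> ext_period (stake (Suc n) y) ?x"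
      using max[rule_format, of u "Suc (Suc n)"] char_sturmian_shift_cycle[of v, folded u_def] same
        min_period_psi_stake_Suc[of "Suc n" y]
      by (simp add: v_def min_period_psi_snoc del: stake.simps snth.simps)
    \<comment> \<open>After \<open>?x\<close> has been appended, the component of
      \<open>exch ?x\<close> exceeds that of \<open>?x\<close> by its own previous value, which is
      positive.\<close>
    moreover have "?x \<noteq> exch ?x" by (cases ?x) simp_all
    ultimately show False
      using ext_period_pos[of "stake n y" "exch ?x"]
      by (simp add: stake_Suc ext_period_snoc del: stake.simps)
  qed
next
  assume alt: "alternating y"
  have "min_period (psi (stake n u)) \<le> min_period (psi (stake n y))" for n and u :: "letter stream"
  proof (cases n)
    \<comment> \<open>At order \<open>Suc m\<close> the bound \<open>fib (m + 2)\<close> holds for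
      \<open>u\<close> and is attained by \<open>y\<close>; at order 0 both prefixes are
      empty.\<close>
    case (Suc m)
    then show ?thesis
      using ext_period_le_fib(1)[of "stake m u" "u !! m"] ext_period_alternating[OF alt, of m]
      by (simp only: min_period_psi_stake_Suc length_stake)
  qed simp
  then show "\<forall>n u. char_sturmian (psi_inf u) \<longrightarrow>
    min_period (psi (stake n u)) \<le> min_period (psi (stake n y))" by blast
qed

theorem theorem4p6:
  fixes s y :: "letter stream"
  assumes "s = psi_inf y" and "char_sturmian s"
  shows "(\<forall>n u. char_sturmian (psi_inf u) \<longrightarrow>
            min_period (psi (stake n y)) \<ge> min_period (psi (stake n u)))
         \<longleftrightarrow> (s = fibonacci_word \<or> s = smap exch fibonacci_word)"
proof -
  \<comment> \<open>Both target words are limits of alternating directive words, so injectivity of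
    \<open>psi_inf\<close> turns equality of words into a condition on \<open>y\<close>.\<close>
  have "s = fibonacci_word \<or> s = smap exch fibonacci_word \<longleftrightarrow> alternating y"
    unfolding assms(1) fibonacci_word_def psi_inf_smap_exch[symmetric] alternating_iff
    by (blast dest: inj_psi_inf)
  with min_period_psi_maximal_iff[of y] show ?thesis by simp
qed

end
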